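(* Let $\mathfrak{Gpd}_{\mathbb{T}}$ be the category of tame groupoids (and functors between them), and suppose $\mu:\mathrm{Ob}(\mathfrak{Gpd}_{\mathbb{T}})\to \mathbb{R}$ is a function satisfying the following conditions. (i) If $\mathcal{G}$ and $\mathcal{H}$ are tame groupoids and $\mathcal{G}$ is equivalent to $\mathcal{H}$, then $\mu(\mathcal{G})=\mu(\mathcal{H})$. (ii) If $\bullet$ denotes a groupoid with one object and one morphism, then $\mu(\bullet)=1$. (iii) If $F:\mathcal{G}\to \mathcal{H}$ is a $k$-sheeted covering between tame groupoids, then $\mu(\mathcal{G})=k\,\mu(\mathcal{H})$. (iv) $\mu(\mathcal{G}\sqcup \mathcal{H})=\mu(\mathcal{G})+\mu(\mathcal{H})$ for all tame groupoids $\mathcal{G}$ and $\mathcal{H}$. (v) If $\mathcal{G}^{(0)}\hookrightarrow\mathcal{G}^{(1)}\hookrightarrow\cdots$ is a filtration of a tame groupoid $\mathcal{G}$, then $\lim_{n\to\infty}\mu(\mathcal{G}^{(n)})=\mu(\mathcal{G})$. Then $\mu=\chi$, the groupoid cardinality.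
   Context: All groupoids $\mathcal{G}$ are assumed to have a countable set $[\mathcal{G}]$ of isomorphism classes and a finite automorphism group $\mathrm{Aut}(x)$ for every object $x$. The groupoid cardinality of $\mathcal{G}$ is $\chi(\mathcal{G})=\sum_{[x]\in[\mathcal{G}]}\frac{1}{\#\mathrm{Aut}(x)}\in[0,\infty]$, and $\mathcal{G}$ is tame if $\chi(\mathcal{G})<\infty$. Filtration: let $\mathcal{G}$ be a tame groupoid and $f:[\mathcal{G}]\to\mathbb{N}=\{0,1,2,\dots\}$ a surjection. Let $\mathcal{G}_n=f^{-1}(n)$ (the full subgroupoid of $\mathcal{G}$ on the objects whose isomorphism class is sent to $n$) and $\mathcal{G}^{(n)}=\coprod_{i=0}^n\mathcal{G}_i$. The sequence $\mathcal{G}^{(0)}\hookrightarrow\mathcal{G}^{(1)}\hookrightarrow\cdots$ is called a filtration of $\mathcal{G}$. $k$-sheeted covering ($k$ a natural number): a functor $F:\mathcal{G}\to\mathcal{H}$ between groupoids such that (1) $F$ is surjective on objects; (2) given a morphism $h_1\to h_2$ in $\mathcal{H}$ and an object $g_1$ of $\mathcal{G}$ with $F(g_1)=h_1$, there is a unique morphism $g_1\to g_2$ in $\mathcal{G}$ (with source $g_1$) mapped by $F$ to $h_1\to h_2$; (3) the preimage of every object of $\mathcal{H}$ consists of $k$ objects of $\mathcal{G}$. $\sqcup$ denotes disjoint union of groupoids. *)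

theory Defs
  imports "HOL-Analysis.Infinite_Sum" "HOL-Library.Infinite_Typeclass"
begin

text \<open>Small categories with objects in the type 'o and arrows in the type 'm. Values of the
  operations outside \<open>Obj\<close>, \<open>Arr\<close>, and outside the composable pairs, carry no information.
  \<open>Comp C g f\<close> is ``\<open>g\<close> after \<open>f\<close>''.\<close>

record ('o, 'm) cat_data =
  Obj :: "'o set"
  Arr :: "'m set"
  Src :: "'m \<Rightarrow> 'o"
  Tgt :: "'m \<Rightarrow> 'o"
  Ident :: "'o \<Rightarrow> 'm"
  Comp :: "'m \<Rightarrow> 'm \<Rightarrow> 'm"

definition Hom :: "('o, 'm) cat_data \<Rightarrow> 'o \<Rightarrow> 'o \<Rightarrow> 'm set" where
  "Hom C x y = {f \<in> Arr C. Src C f = x \<and> Tgt C f = y}"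

definition category :: "('o, 'm) cat_data \<Rightarrow> bool" where
  "category C \<longleftrightarrow>
     (\<forall>f\<in>Arr C. Src C f \<in> Obj C \<and> Tgt C f \<in> Obj C) \<and>
     (\<forall>x\<in>Obj C. Ident C x \<in> Hom C x x) \<and>
     (\<forall>f\<in>Arr C. \<forall>g\<in>Arr C. Src C g = Tgt C f \<longrightarrow> Comp C g f \<in> Hom C (Src C f) (Tgt C g)) \<and>
     (\<forall>f\<in>Arr C. Comp C f (Ident C (Src C f)) = f \<and> Comp C (Ident C (Tgt C f)) f = f) \<and>
     (\<forall>f\<in>Arr C. \<forall>g\<in>Arr C. \<forall>h\<in>Arr C. Src C g = Tgt C f \<longrightarrow> Src C h = Tgt C g \<longrightarrow>
        Comp C h (Comp C g f) = Comp C (Comp C h g) f)"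

definition Isos :: "('o, 'm) cat_data \<Rightarrow> 'o \<Rightarrow> 'o \<Rightarrow> 'm set" where
  "Isos C x y = {f \<in> Hom C x y. \<exists>g\<in>Hom C y x. Comp C g f = Ident C x \<and> Comp C f g = Ident C y}"

abbreviation Aut :: "('o, 'm) cat_data \<Rightarrow> 'o \<Rightarrow> 'm set" where
  "Aut C x \<equiv> Isos C x x"

definition groupoid :: "('o, 'm) cat_data \<Rightarrow> bool" where
  "groupoid G \<longleftrightarrow> category G \<and> (\<forall>f\<in>Arr G. f \<in> Isos G (Src G f) (Tgt G f))"

text \<open>A functor is given by its object map and its arrow map.\<close>

definition is_functor ::
  "('o, 'm) cat_data \<Rightarrow> ('p, 'n) cat_data \<Rightarrow> ('o \<Rightarrow> 'p) \<Rightarrow> ('m \<Rightarrow> 'n) \<Rightarrow> bool" where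
  "is_functor C D Fo Fa \<longleftrightarrow>
     category C \<and> category D \<and>
     (\<forall>x\<in>Obj C. Fo x \<in> Obj D) \<and>
     (\<forall>f\<in>Arr C. Fa f \<in> Hom D (Fo (Src C f)) (Fo (Tgt C f))) \<and>
     (\<forall>x\<in>Obj C. Fa (Ident C x) = Ident D (Fo x)) \<and>
     (\<forall>f\<in>Arr C. \<forall>g\<in>Arr C. Src C g = Tgt C f \<longrightarrow> Fa (Comp C g f) = Comp D (Fa g) (Fa f))"

definition is_natural_iso ::
  "('o, 'm) cat_data \<Rightarrow> ('p, 'n) cat_data \<Rightarrow> ('o \<Rightarrow> 'p) \<Rightarrow> ('m \<Rightarrow> 'n) \<Rightarrow> ('o \<Rightarrow> 'p) \<Rightarrow> ('m \<Rightarrow> 'n)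
     \<Rightarrow> ('o \<Rightarrow> 'n) \<Rightarrow> bool" where
  "is_natural_iso C D Fo Fa Ko Ka \<eta> \<longleftrightarrow>
     is_functor C D Fo Fa \<and> is_functor C D Ko Ka \<and>
     (\<forall>x\<in>Obj C. \<eta> x \<in> Isos D (Fo x) (Ko x)) \<and>
     (\<forall>f\<in>Arr C. Comp D (\<eta> (Tgt C f)) (Fa f) = Comp D (Ka f) (\<eta> (Src C f)))"

definition equivalent :: "('o, 'm) cat_data \<Rightarrow> ('p, 'n) cat_data \<Rightarrow> bool" where
  "equivalent C D \<longleftrightarrow>
     (\<exists>Fo Fa Ko Ka \<eta> \<epsilon>. is_functor C D Fo Fa \<and> is_functor D C Ko Ka \<and>
        is_natural_iso C C id id (Ko \<circ> Fo) (Ka \<circ> Fa) \<eta> \<and>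
        is_natural_iso D D (Fo \<circ> Ko) (Fa \<circ> Ka) id id \<epsilon>)"

definition isomorphic :: "('o, 'm) cat_data \<Rightarrow> ('p, 'n) cat_data \<Rightarrow> bool" where
  "isomorphic C D \<longleftrightarrow>
     (\<exists>Fo Fa. is_functor C D Fo Fa \<and> bij_betw Fo (Obj C) (Obj D) \<and> bij_betw Fa (Arr C) (Arr D))"

definition iso_class :: "('o, 'm) cat_data \<Rightarrow> 'o \<Rightarrow> 'o set" where
  "iso_class C x = {y \<in> Obj C. Isos C x y \<noteq> {}}"

definition iso_classes :: "('o, 'm) cat_data \<Rightarrow> 'o set set" where
  "iso_classes C = iso_class C ` Obj C"

text \<open>The summand does not depend on the representative chosen by \<open>SOME\<close>, see
  \<open>card_Aut_iso_class\<close> below. The sum is over a possibly infinite set and takes values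
  in \<open>[0, \<infinity>]\<close>.\<close>

definition groupoid_card :: "('o, 'm) cat_data \<Rightarrow> ennreal" where
  "groupoid_card G = (\<Sum>\<^sub>\<infinity>c\<in>iso_classes G. 1 / of_nat (card (Aut G (SOME x. x \<in> c))))"

definition tame :: "('o, 'm) cat_data \<Rightarrow> bool" where
  "tame G \<longleftrightarrow> groupoid G \<and> countable (iso_classes G) \<and> (\<forall>x\<in>Obj G. finite (Aut G x)) \<and>
     groupoid_card G < \<infinity>"

text \<open>Finiteness of the fibres is demanded separately since \<open>card\<close> is 0 on infinite sets.\<close>

definition sheeted_covering ::
  "nat \<Rightarrow> ('o, 'm) cat_data \<Rightarrow> ('p, 'n) cat_data \<Rightarrow> ('o \<Rightarrow> 'p) \<Rightarrow> ('m \<Rightarrow> 'n) \<Rightarrow> bool" where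
  "sheeted_covering k G H Fo Fa \<longleftrightarrow>
     groupoid G \<and> groupoid H \<and> is_functor G H Fo Fa \<and>
     Fo ` Obj G = Obj H \<and>
     (\<forall>h\<in>Arr H. \<forall>x\<in>Obj G. Fo x = Src H h \<longrightarrow> (\<exists>!g. g \<in> Arr G \<and> Src G g = x \<and> Fa g = h)) \<and>
     (\<forall>y\<in>Obj H. finite {x \<in> Obj G. Fo x = y} \<and> card {x \<in> Obj G. Fo x = y} = k)"

text \<open>The disjoint union lives over the sum types. Within fixed types 'o and 'm, ``\<open>K\<close> is the
  disjoint union of \<open>G\<close> and \<open>H\<close>'' is expressed as \<open>isomorphic K (disjoint_union G H)\<close>; if 'o and
  'm are infinite, such a \<open>K\<close> always exists.\<close>

definition disjoint_union ::
  "('o, 'm) cat_data \<Rightarrow> ('p, 'n) cat_data \<Rightarrow> ('o + 'p, 'm + 'n) cat_data" where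
  "disjoint_union G H =
     \<lparr>Obj = Obj G <+> Obj H,
      Arr = Arr G <+> Arr H,
      Src = map_sum (Src G) (Src H),
      Tgt = map_sum (Tgt G) (Tgt H),
      Ident = map_sum (Ident G) (Ident H),
      Comp = (\<lambda>b a. case (b, a) of
                 (Inl g, Inl f) \<Rightarrow> Inl (Comp G g f)
               | (Inr g, Inr f) \<Rightarrow> Inr (Comp H g f)
               | _ \<Rightarrow> undefined)\<rparr>"

definition full_subcat :: "('o, 'm) cat_data \<Rightarrow> 'o set \<Rightarrow> ('o, 'm) cat_data" where
  "full_subcat C S =
     C\<lparr>Obj := {x \<in> Obj C. x \<in> S}, Arr := {f \<in> Arr C. Src C f \<in> S \<and> Tgt C f \<in> S}\<rparr>"

definition filtration_piece :: "('o, 'm) cat_data \<Rightarrow> ('o set \<Rightarrow> nat) \<Rightarrow> nat \<Rightarrow> ('o, 'm) cat_data" where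
  "filtration_piece G f n = full_subcat G {x. f (iso_class G x) = n}"

text \<open>The pieces are pairwise disjoint, so their coproduct is formed as a union inside \<open>G\<close>;
  the inclusions between the stages are then literal.\<close>

definition filtration_stage :: "('o, 'm) cat_data \<Rightarrow> ('o set \<Rightarrow> nat) \<Rightarrow> nat \<Rightarrow> ('o, 'm) cat_data" where
  "filtration_stage G f n =
     G\<lparr>Obj := (\<Union>i\<le>n. Obj (filtration_piece G f i)), Arr := (\<Union>i\<le>n. Arr (filtration_piece G f i))\<rparr>"

lemma Isos_eq_Hom: "groupoid G \<Longrightarrow> Isos G x y = Hom G x y"
  by (auto simp: groupoid_def Isos_def Hom_def)

lemma category_comp:
  "category C \<Longrightarrow> f \<in> Hom C x y \<Longrightarrow> g \<in> Hom C y z \<Longrightarrow> Comp C g f \<in> Hom C x z"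
  by (auto simp: category_def Hom_def)

lemma card_Aut_iso_class:
  assumes G: "groupoid G" and y: "y \<in> iso_class G x"
  shows "card (Aut G y) = card (Aut G x)"
proof -
  have C: "category G" using G by (simp add: groupoid_def)
  obtain f g where f: "f \<in> Hom G x y" and g: "g \<in> Hom G y x"
    and gf: "Comp G g f = Ident G x" and fg: "Comp G f g = Ident G y"
    using y by (auto simp: iso_class_def Isos_def)
  have assoc: "Comp G c (Comp G b a) = Comp G (Comp G c b) a"
    if "a \<in> Hom G p q" "b \<in> Hom G q r" "c \<in> Hom G r s" for a b c p q r s
    using C that by (auto simp: category_def Hom_def)
  have unit: "Comp G a (Ident G p) = a" "Comp G (Ident G q) a = a" if "a \<in> Hom G p q" for a p q
    using C that by (auto simp: category_def Hom_def)
  note comp = category_comp[OF C]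
  have "bij_betw (\<lambda>a. Comp G g (Comp G a f)) (Hom G y y) (Hom G x x)"
  proof (rule bij_betw_byWitness[where f' = "\<lambda>b. Comp G f (Comp G b g)"])
    show "\<forall>a\<in>Hom G y y. Comp G f (Comp G (Comp G g (Comp G a f)) g) = a"
    proof
      fix a assume a: "a \<in> Hom G y y"
      have af: "Comp G a f \<in> Hom G x y" using comp f a by blast
      have "Comp G (Comp G g (Comp G a f)) g = Comp G g (Comp G (Comp G a f) g)"
        using assoc[OF g af g] by simp
      also have "Comp G (Comp G a f) g = a" using assoc[OF g f a] unit(1)[OF a] fg by simp
      finally show "Comp G f (Comp G (Comp G g (Comp G a f)) g) = a"
        using assoc[OF a g f] unit(2)[OF a] fg by simp
    qed
    show "\<forall>b\<in>Hom G x x. Comp G g (Comp G (Comp G f (Comp G b g)) f) = b"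
    proof
      fix b assume b: "b \<in> Hom G x x"
      have bg: "Comp G b g \<in> Hom G y x" using comp g b by blast
      have "Comp G (Comp G f (Comp G b g)) f = Comp G f (Comp G (Comp G b g) f)"
        using assoc[OF f bg f] by simp
      also have "Comp G (Comp G b g) f = b" using assoc[OF f g b] unit(1)[OF b] gf by simp
      finally show "Comp G g (Comp G (Comp G f (Comp G b g)) f) = b"
        using assoc[OF b f g] unit(2)[OF b] gf by simp
    qed
    show "(\<lambda>a. Comp G g (Comp G a f)) ` Hom G y y \<subseteq> Hom G x x" using comp f g by blast
    show "(\<lambda>b. Comp G f (Comp G b g)) ` Hom G x x \<subseteq> Hom G y y" using comp f g by blast
  qed
  then show ?thesis by (simp add: Isos_eq_Hom[OF G] bij_betw_same_card)
qed

end

theory Submission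
  imports Defs
begin

text \<open>Additivity and the filtration axiom reduce the claim to a connected groupoid, which is
  equivalent to a group \<open>A\<close> of order \<open>n\<close> regarded as a groupoid with one object. The action groupoid
  of \<open>A\<close> acting on itself by translation is an \<open>n\<close>-sheeted covering of it and is equivalent to a
  point, so its value under \<open>\<mu>\<close> is 1 and \<open>\<mu> A = 1 / n\<close>.\<close>

section \<open>Calculation in a groupoid\<close>

definition inv_arr :: "('o, 'm) cat_data \<Rightarrow> 'm \<Rightarrow> 'm" where
  "inv_arr G f = (SOME g. g \<in> Hom G (Tgt G f) (Src G f) \<and>
     Comp G g f = Ident G (Src G f) \<and> Comp G f g = Ident G (Tgt G f))"

context
  fixes G :: "('o, 'm) cat_data"
  assumes G: "groupoid G"
begin

lemma groupoid_category: "category G"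
  using G by (simp add: groupoid_def)

lemma Comp_in_Hom: "f \<in> Hom G x y \<Longrightarrow> g \<in> Hom G y z \<Longrightarrow> Comp G g f \<in> Hom G x z"
  using category_comp[OF groupoid_category] .

lemma Comp_assoc:
  "f \<in> Hom G x y \<Longrightarrow> g \<in> Hom G y z \<Longrightarrow> h \<in> Hom G z w \<Longrightarrow>
    Comp G (Comp G h g) f = Comp G h (Comp G g f)"
  using groupoid_category by (auto simp: category_def Hom_def)

lemma Comp_Ident_right: "f \<in> Hom G x y \<Longrightarrow> Comp G f (Ident G x) = f"
  and Comp_Ident_left: "f \<in> Hom G x y \<Longrightarrow> Comp G (Ident G y) f = f"
  using groupoid_category by (auto simp: category_def Hom_def)

lemma Ident_in_Hom: "x \<in> Obj G \<Longrightarrow> Ident G x \<in> Hom G x x"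
  using groupoid_category by (auto simp: category_def)

lemma Arr_in_Hom: "f \<in> Arr G \<Longrightarrow> f \<in> Hom G (Src G f) (Tgt G f)"
  by (simp add: Hom_def)

lemma Src_in_Obj: "f \<in> Arr G \<Longrightarrow> Src G f \<in> Obj G"
  and Tgt_in_Obj: "f \<in> Arr G \<Longrightarrow> Tgt G f \<in> Obj G"
  using groupoid_category by (auto simp: category_def)

lemma Hom_Obj: "f \<in> Hom G x y \<Longrightarrow> x \<in> Obj G \<and> y \<in> Obj G"
  using groupoid_category by (auto simp: category_def Hom_def)

lemma inv_arr:
  assumes "f \<in> Hom G x y"
  shows inv_arr_in_Hom: "inv_arr G f \<in> Hom G y x"
    and inv_arr_Comp: "Comp G (inv_arr G f) f = Ident G x"
    and Comp_inv_arr: "Comp G f (inv_arr G f) = Ident G y"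
proof -
  have "f \<in> Isos G (Src G f) (Tgt G f)"
    using assms G by (auto simp: groupoid_def Hom_def)
  then have "\<exists>g. g \<in> Hom G (Tgt G f) (Src G f) \<and>
     Comp G g f = Ident G (Src G f) \<and> Comp G f g = Ident G (Tgt G f)"
    by (auto simp: Isos_def)
  from someI_ex[OF this] assms
  show "inv_arr G f \<in> Hom G y x" "Comp G (inv_arr G f) f = Ident G x"
    "Comp G f (inv_arr G f) = Ident G y"
    by (auto simp: inv_arr_def Hom_def)
qed

lemma inv_arr_Comp_cancel: "f \<in> Hom G x y \<Longrightarrow> h \<in> Hom G w x \<Longrightarrow>
    Comp G (inv_arr G f) (Comp G f h) = h"
  by (metis Comp_assoc inv_arr_in_Hom inv_arr_Comp Comp_Ident_left)

lemma Isos_Ident: "x \<in> Obj G \<Longrightarrow> Ident G x \<in> Isos G x x"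
  using Ident_in_Hom by (simp add: Isos_eq_Hom[OF G])

lemma iso_class_self: "x \<in> Obj G \<Longrightarrow> x \<in> iso_class G x"
  using Isos_Ident by (auto simp: iso_class_def)

text \<open>Composing with an arrow from \<open>x\<close> to \<open>y\<close>, or with its inverse,
  carries arrows out of one object to arrows out of the other, so both reach the same
  objects.\<close>

lemma iso_class_eq_iff:
  assumes "x \<in> Obj G" "y \<in> Obj G"
  shows "iso_class G x = iso_class G y \<longleftrightarrow> Hom G x y \<noteq> {}"
proof
  assume "iso_class G x = iso_class G y"
  then show "Hom G x y \<noteq> {}"
    using iso_class_self[OF assms(2)] by (auto simp: iso_class_def Isos_eq_Hom[OF G])
next
  assume "Hom G x y \<noteq> {}"
  then obtain f where f: "f \<in> Hom G x y" by blast
  have "Hom G x z \<noteq> {} \<longleftrightarrow> Hom G y z \<noteq> {}" for z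
    using Comp_in_Hom[OF f] Comp_in_Hom[OF inv_arr_in_Hom[OF f]] by blast
  then show "iso_class G x = iso_class G y"
    by (auto simp: iso_class_def Isos_eq_Hom[OF G])
qed

lemma iso_class_Src_Tgt: "f \<in> Arr G \<Longrightarrow> iso_class G (Src G f) = iso_class G (Tgt G f)"
  using iso_class_eq_iff Src_in_Obj Tgt_in_Obj Arr_in_Hom by blast

text \<open>Isomorphism classes are the blocks of a partition of the objects; in this form it is
  used to see that two classes sharing an object coincide.\<close>

lemma mem_iso_classes_iff: "c \<in> iso_classes G \<Longrightarrow> x \<in> c \<longleftrightarrow> x \<in> Obj G \<and> iso_class G x = c"
proof -
  assume "c \<in> iso_classes G"
  then obtain y where y: "y \<in> Obj G" "c = iso_class G y"
    by (auto simp: iso_classes_def)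
  then show ?thesis
    using iso_class_eq_iff[OF y(1), of x] by (auto simp: iso_class_def Isos_eq_Hom[OF G])
qed

lemma some_mem_iso_class: "c \<in> iso_classes G \<Longrightarrow> (SOME x. x \<in> c) \<in> c"
  using iso_class_self unfolding iso_classes_def by (metis imageE someI)

lemma card_Aut_pos:
  assumes "x \<in> Obj G" "finite (Aut G x)"
  shows "card (Aut G x) > 0"
  using Isos_Ident assms by (auto simp: card_gt_0_iff)

text \<open>The cardinality is a finite sum here. Each summand is finite because the identity keeps
  the automorphism group nonempty; an empty one would give 1 / 0 = \<infinity> in
  \<open>ennreal\<close>.\<close>

lemma tame_if_finite_iso_classes:
  assumes fin: "finite (iso_classes G)" and Aut: "\<And>x. x \<in> Obj G \<Longrightarrow> finite (Aut G x)"
  shows "tame G"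
proof -
  have "1 / of_nat (card (Aut G (SOME x. x \<in> c))) \<noteq> (\<infinity> :: ennreal)" if c: "c \<in> iso_classes G" for c
  proof -
    have "card (Aut G (SOME x. x \<in> c)) > 0"
      using some_mem_iso_class[OF c] card_Aut_pos Aut mem_iso_classes_iff[OF c] by blast
    then show ?thesis by (simp add: ennreal_divide_eq_top_iff)
  qed
  then have "groupoid_card G < \<infinity>"
    using fin by (auto simp: groupoid_card_def less_top)
  then show ?thesis
    using G Aut fin by (simp add: tame_def countable_finite)
qed

section \<open>Full subgroupoids\<close>

lemma groupoid_full_subcat: "groupoid (full_subcat G S)"
proof -
  have Hom: "Hom (full_subcat G S) x y = (if x \<in> S \<and> y \<in> S then Hom G x y else {})" for x y
    by (auto simp: Hom_def full_subcat_def)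
  have "category (full_subcat G S)"
    using groupoid_category
    by (auto simp: category_def Hom) (auto simp: full_subcat_def Hom_def)
  moreover have "f \<in> Isos (full_subcat G S) (Src G f) (Tgt G f)"
    if f: "f \<in> Arr (full_subcat G S)" for f
  proof -
    have f: "f \<in> Hom G (Src G f) (Tgt G f)" "Src G f \<in> S" "Tgt G f \<in> S"
      using f by (auto simp: Hom_def full_subcat_def)
    show ?thesis
      using f inv_arr[OF f(1)] by (auto simp: Isos_def Hom) (auto simp: full_subcat_def)
  qed
  ultimately show ?thesis
    by (simp add: groupoid_def) (simp add: full_subcat_def)
qed

end

lemma Hom_full_subcat:
  "Hom (full_subcat G S) x y = (if x \<in> S \<and> y \<in> S then Hom G x y else {})"
  by (auto simp: Hom_def full_subcat_def)

lemma full_subcat_simps [simp]: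
  "Obj (full_subcat G S) = Obj G \<inter> S"
  "Arr (full_subcat G S) = {f \<in> Arr G. Src G f \<in> S \<and> Tgt G f \<in> S}"
  "Src (full_subcat G S) = Src G"
  "Tgt (full_subcat G S) = Tgt G"
  "Ident (full_subcat G S) = Ident G"
  "Comp (full_subcat G S) = Comp G"
  by (auto simp: full_subcat_def)

lemma full_subcat_full_subcat: "full_subcat (full_subcat G S) T = full_subcat G (S \<inter> T)"
  by (auto simp: full_subcat_def intro!: cat_data.equality)

lemma full_subcat_Obj:
  assumes "groupoid G" "Obj G \<subseteq> S"
  shows "full_subcat G S = G"
  using assms(2) Src_in_Obj[OF assms(1)] Tgt_in_Obj[OF assms(1)]
  by (auto intro!: cat_data.equality simp: subset_iff)

lemma Isos_full_subcat:
  assumes "groupoid G"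
  shows "Isos (full_subcat G S) x y = (if x \<in> S \<and> y \<in> S then Isos G x y else {})"
  by (simp add: Isos_eq_Hom assms groupoid_full_subcat Hom_full_subcat)

text \<open>By fullness, passing to the subgroupoid only cuts the class of an object of
  \<open>S\<close> down to \<open>S\<close>. Counting the classes of \<open>G\<close> that meet
  \<open>S\<close> thus bounds those of the subgroupoid, which later yields tameness.\<close>

lemma iso_classes_full_subcat:
  assumes "groupoid G"
  shows "iso_classes (full_subcat G S) \<subseteq> (\<lambda>c. c \<inter> S) ` {c \<in> iso_classes G. c \<inter> S \<noteq> {}}"
proof -
  have "iso_class (full_subcat G S) x = iso_class G x \<inter> S" if "x \<in> S" for x
    using that by (auto simp: iso_class_def Isos_full_subcat assms)
  then show ?thesis
    using iso_class_self[OF assms] by (fastforce simp: iso_classes_def)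
qed

text \<open>The inclusion is fully faithful, and the hypothesis makes it essentially surjective. A
  quasi-inverse is built by hand: each object \<open>x\<close> moves along a chosen arrow
  \<open>\<phi> x\<close> to an object \<open>r x\<close> of \<open>S\<close>, and arrows are
  conjugated accordingly.\<close>

lemma equivalent_full_subcat:
  assumes G: "groupoid G" and S: "\<And>x. x \<in> Obj G \<Longrightarrow> \<exists>y\<in>S. Hom G x y \<noteq> {}"
  shows "equivalent (full_subcat G S) G"
proof -
  let ?S = "full_subcat G S"
  note GS = groupoid_full_subcat[OF G, of S]
  have "\<exists>f. \<exists>y\<in>S. f \<in> Hom G x y" if "x \<in> Obj G" for x
    using S[OF that] by blast
  then obtain \<phi> r where \<phi>: "\<And>x. x \<in> Obj G \<Longrightarrow> \<phi> x \<in> Hom G x (r x)"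
    and r: "\<And>x. x \<in> Obj G \<Longrightarrow> r x \<in> S"
    by metis
  \<comment> \<open>The only choice making \<open>\<phi>\<close> natural from the identity to the
    functor \<open>r\<close>, \<open>K\<close>. The facts \<open>K(3)\<close> and
    \<open>K(4)\<close> below are the naturality squares of \<open>\<phi>\<close> and of its
    inverse.\<close>
  define K where "K f = Comp G (Comp G (\<phi> (Tgt G f)) f) (inv_arr G (\<phi> (Src G f)))" for f
  note C = Comp_in_Hom[OF G] and I = inv_arr_in_Hom[OF G]
  have K: "K f = Comp G (Comp G (\<phi> y) f) (inv_arr G (\<phi> x))" "K f \<in> Hom G (r x) (r y)"
    "Comp G (K f) (\<phi> x) = Comp G (\<phi> y) f"
    "Comp G (inv_arr G (\<phi> y)) (K f) = Comp G f (inv_arr G (\<phi> x))"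
    if f: "f \<in> Hom G x y" for f x y
  proof -
    have xy: "x \<in> Obj G" "y \<in> Obj G" using Hom_Obj[OF G f] by auto
    note px = \<phi>[OF xy(1)] and py = \<phi>[OF xy(2)]
    note yf = C[OF f py]
    show 1: "K f = Comp G (Comp G (\<phi> y) f) (inv_arr G (\<phi> x))"
      using f by (simp add: K_def Hom_def)
    show "K f \<in> Hom G (r x) (r y)"
      unfolding 1 using C[OF I[OF px] yf] .
    show "Comp G (K f) (\<phi> x) = Comp G (\<phi> y) f"
      unfolding 1
      using Comp_assoc[OF G px I[OF px] yf] inv_arr_Comp[OF G px] Comp_Ident_right[OF G yf] by simp
    show "Comp G (inv_arr G (\<phi> y)) (K f) = Comp G f (inv_arr G (\<phi> x))"
      unfolding 1 Comp_assoc[OF G I[OF px] f py]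
      using inv_arr_Comp_cancel[OF G py C[OF I[OF px] f]] .
  qed
  have K_Ident: "K (Ident G x) = Ident G (r x)" if x: "x \<in> Obj G" for x
    using K(1)[OF Ident_in_Hom[OF G x]] Comp_Ident_right[OF G \<phi>[OF x]] Comp_inv_arr[OF G \<phi>[OF x]]
    by simp
  have K_Comp: "K (Comp G g f) = Comp G (K g) (K f)"
    if f: "f \<in> Hom G x y" and g: "g \<in> Hom G y z" for f g x y z
  proof -
    have xyz: "x \<in> Obj G" "y \<in> Obj G" "z \<in> Obj G" using Hom_Obj[OF G f] Hom_Obj[OF G g] by auto
    note px = \<phi>[OF xyz(1)] and py = \<phi>[OF xyz(2)] and pz = \<phi>[OF xyz(3)]
    \<comment> \<open>The factor \<open>inv_arr G (\<phi> y)\<close> of \<open>K g\<close> meets the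
      factor \<open>\<phi> y\<close> of \<open>K f\<close>; \<open>K(4)\<close> performs the
      cancellation.\<close>
    have "Comp G (K g) (K f) = Comp G (Comp G (\<phi> z) g) (Comp G (inv_arr G (\<phi> y)) (K f))"
      unfolding K(1)[OF g] by (rule Comp_assoc[OF G K(2)[OF f] I[OF py] C[OF g pz]])
    also have "\<dots> = Comp G (Comp G (\<phi> z) g) (Comp G f (inv_arr G (\<phi> x)))"
      using K(4)[OF f] by simp
    also have "\<dots> = Comp G (Comp G (Comp G (\<phi> z) g) f) (inv_arr G (\<phi> x))"
      by (rule Comp_assoc[OF G I[OF px] f C[OF g pz], symmetric])
    also have "\<dots> = K (Comp G g f)"
      unfolding K(1)[OF C[OF f g]] Comp_assoc[OF G f g pz] ..
    finally show ?thesis by simp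
  qed
  have cat: "category G" "category ?S"
    using groupoid_category G GS by blast+
  have F: "is_functor ?S G id id"
    using cat Ident_in_Hom[OF G] by (auto simp: is_functor_def Hom_def)
  have KF: "is_functor G ?S r K"
    unfolding is_functor_def
  proof (intro conjI ballI impI cat)
    fix f g assume f: "f \<in> Arr G" and g: "g \<in> Arr G" "Src G g = Tgt G f"
    show "K (Comp G g f) = Comp ?S (K g) (K f)"
      using K_Comp[OF Arr_in_Hom[OF G f], of g] g by (simp add: Hom_def)
  qed (use K_Ident r \<phi> Hom_Obj[OF G \<phi>] K(2)[OF Arr_in_Hom[OF G]] Src_in_Obj[OF G] Tgt_in_Obj[OF G]
      in \<open>simp_all add: Hom_full_subcat\<close>)
  have id: "is_functor C C id id" if "category C" for C :: "('a, 'b) cat_data"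
    using that by (auto simp: is_functor_def Hom_def)
  \<comment> \<open>Composing with the inclusion on either side leaves the maps \<open>r\<close> and
    \<open>K\<close> unchanged; only the source or target category differs.\<close>
  have restr: "is_functor ?S ?S r K"
    using KF cat by (auto simp: is_functor_def)
  have ext: "is_functor G G r K"
    using KF cat by (auto simp: is_functor_def Hom_full_subcat split: if_splits)
  have "is_natural_iso ?S ?S id id (r \<circ> id) (K \<circ> id) \<phi>"
    using id[OF cat(2)] restr \<phi> r K(3)[OF Arr_in_Hom[OF G]]
    by (auto simp: is_natural_iso_def Isos_eq_Hom GS Hom_full_subcat)
  moreover have "is_natural_iso G G (id \<circ> r) (id \<circ> K) id id (\<lambda>x. inv_arr G (\<phi> x))"
    using id[OF cat(1)] ext I[OF \<phi>] K(4)[OF Arr_in_Hom[OF G]]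
    by (auto simp: is_natural_iso_def Isos_eq_Hom G)
  ultimately show ?thesis
    unfolding equivalent_def using F KF by blast
qed

text \<open>No arrow crosses the boundary of \<open>S\<close> or of \<open>T\<close>, so each arrow
  inside \<open>S \<union> T\<close> lies entirely in one of the two parts. Tagging objects and
  arrows with their part is then an isomorphism; for an arrow the source decides the tag.\<close>

lemma isomorphic_disjoint_union_full_subcat:
  assumes G: "groupoid G" and disj: "S \<inter> T = {}"
    and S: "\<And>f. f \<in> Arr G \<Longrightarrow> Src G f \<in> S \<longleftrightarrow> Tgt G f \<in> S"
    and T: "\<And>f. f \<in> Arr G \<Longrightarrow> Src G f \<in> T \<longleftrightarrow> Tgt G f \<in> T"
  shows "isomorphic (full_subcat G (S \<union> T)) (disjoint_union (full_subcat G S) (full_subcat G T))"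
proof -
  let ?D = "disjoint_union (full_subcat G S) (full_subcat G T)"
  define Fo where "Fo x = (if x \<in> S then Inl x else Inr x)" for x
  define Fa where "Fa f = (if Src G f \<in> S then Inl f else Inr f)" for f
  have D: "Obj ?D = (Obj G \<inter> S) <+> (Obj G \<inter> T)"
    "Arr ?D = {f \<in> Arr G. Src G f \<in> S \<and> Tgt G f \<in> S} <+> {f \<in> Arr G. Src G f \<in> T \<and> Tgt G f \<in> T}"
    "Src ?D = map_sum (Src G) (Src G)" "Tgt ?D = map_sum (Tgt G) (Tgt G)"
    "Ident ?D = map_sum (Ident G) (Ident G)"
    "\<And>f g. Comp ?D (Inl g) (Inl f) = Inl (Comp G g f)"
    "\<And>f g. Comp ?D (Inr g) (Inr f) = Inr (Comp G g f)"
    by (auto simp: disjoint_union_def)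
  have ax: "category (full_subcat G U)" for U
    using groupoid_category groupoid_full_subcat G by blast
  have "category ?D"
    using ax[of S] ax[of T] unfolding category_def
    by (auto simp: D Hom_def)
  moreover have "Src G (Ident G x) = x" if "x \<in> Obj G" for x
    using Ident_in_Hom[OF G that] by (simp add: Hom_def)
  moreover have "Src G (Comp G g f) = Src G f" if "f \<in> Arr G" "g \<in> Arr G" "Src G g = Tgt G f" for f g
    using Comp_in_Hom[OF G Arr_in_Hom[OF G that(1)]] that by (simp add: Hom_def)
  ultimately have "is_functor (full_subcat G (S \<union> T)) ?D Fo Fa"
    using ax[of "S \<union> T"] S T disj
    by (auto simp: is_functor_def D Hom_def Fo_def Fa_def)
  moreover have "bij_betw Fo (Obj (full_subcat G (S \<union> T))) (Obj ?D)"
    using disj by (auto simp: bij_betw_def inj_on_def D Fo_def image_def split: if_splits)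
  moreover have "bij_betw Fa (Arr (full_subcat G (S \<union> T))) (Arr ?D)"
    using disj S T by (auto simp: bij_betw_def inj_on_def D Fa_def image_def split: if_splits)
  ultimately show ?thesis
    unfolding isomorphic_def by blast
qed

section \<open>The translation covering of a finite group\<close>

text \<open>Makes room for the encodings below: a construction on finitely many elements can be
  copied into any infinite type, so a covering groupoid can have the same types as the groupoid it
  covers.\<close>

lemma ex_inj_on_if_finite:
  assumes "finite A"
  shows "\<exists>f :: 'a \<Rightarrow> 'b::infinite. inj_on f A"
proof -
  obtain B :: "'b set" where "finite B" "card B = card A"
    using infinite_arbitrarily_large[OF infinite_UNIV] by blast
  then show ?thesis
    using finite_same_card_bij[OF assms] by (metis bij_betw_imp_inj_on)
qed

text \<open>\<open>E\<close> is the action groupoid of the group \<open>A\<close> of arrows of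
  \<open>H\<close> acting on itself by left translation: its objects are the elements of
  \<open>A\<close>, an arrow \<open>(a, g)\<close> runs from \<open>a\<close> to \<open>g a\<close>,
  and the covering sends it to \<open>g\<close>, so the only lift of \<open>h\<close> at
  \<open>a\<close> is \<open>(a, h)\<close>. The last three claims record what makes
  \<open>E\<close> equivalent to a point.\<close>

lemma translation_covering:
  fixes H :: "('o::infinite, 'm::infinite) cat_data"
  assumes H: "groupoid H" and x: "Obj H = {x}" and fin: "finite (Arr H)"
  obtains E :: "('o, 'm) cat_data" and Fo Fa y where
    "groupoid E" "finite (Obj E)" "finite (Arr E)" "sheeted_covering (card (Arr H)) E H Fo Fa"
    "y \<in> Obj E" "Arr (full_subcat E {y}) = {Ident E y}" "\<And>z. z \<in> Obj E \<Longrightarrow> Hom E z y \<noteq> {}"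
proof -
  define A where "A = Arr H"
  define i where "i = inv_arr H"
  define u where "u = Ident H x"
  have A: "Hom H x x = A" "\<And>a. a \<in> A \<Longrightarrow> Src H a = x" "\<And>a. a \<in> A \<Longrightarrow> Tgt H a = x"
    using Src_in_Obj[OF H] Tgt_in_Obj[OF H] x by (auto simp: A_def Hom_def)
  have m: "Comp H a b \<in> A" if "a \<in> A" "b \<in> A" for a b
    using Comp_in_Hom[OF H, of b x x a x] that A by simp
  have assoc: "Comp H (Comp H a b) c = Comp H a (Comp H b c)" if "a \<in> A" "b \<in> A" "c \<in> A" for a b c
    using Comp_assoc[OF H, of c x x b x a x] that A by simp
  have u: "u \<in> A" "\<And>a. a \<in> A \<Longrightarrow> Comp H a u = a" "\<And>a. a \<in> A \<Longrightarrow> Comp H u a = a"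
    using Ident_in_Hom[OF H, of x] Comp_Ident_right[OF H, of _ x x] Comp_Ident_left[OF H, of _ x x] x A
    by (auto simp: u_def)
  have i: "i a \<in> A" "Comp H (i a) a = u" "Comp H a (i a) = u" if "a \<in> A" for a
    using inv_arr[OF H, of a x x] that A by (auto simp: i_def u_def)
  have finA: "finite A" using fin by (simp add: A_def)
  \<comment> \<open>\<open>e\<close> encodes group elements as objects and \<open>p\<close> encodes
    pairs of them as arrows; \<open>d\<close> and \<open>q\<close> below decode.\<close>
  obtain e :: "'m \<Rightarrow> 'o" where e: "inj_on e A"
    using ex_inj_on_if_finite[OF finA] by blast
  obtain p :: "'m \<times> 'm \<Rightarrow> 'm" where p: "inj_on p (A \<times> A)"
    using ex_inj_on_if_finite[OF finite_cartesian_product[OF finA finA]] by blast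
  define d where "d = inv_into A e"
  define q where "q = inv_into (A \<times> A) p"
  have d: "d (e a) = a" if "a \<in> A" for a
    using e that by (simp add: d_def)
  have q: "q (p (a, g)) = (a, g)" if "a \<in> A" "g \<in> A" for a g
    using p that by (simp add: q_def)
  define E :: "('o, 'm) cat_data" where "E =
    \<lparr>Obj = e ` A, Arr = p ` (A \<times> A), Src = (\<lambda>f. e (fst (q f))),
     Tgt = (\<lambda>f. e (Comp H (snd (q f)) (fst (q f)))), Ident = (\<lambda>z. p (d z, u)),
     Comp = (\<lambda>g f. p (fst (q f), Comp H (snd (q g)) (snd (q f))))\<rparr>"
  have E: "Obj E = e ` A" "Arr E = p ` (A \<times> A)"
    "\<And>a g. a \<in> A \<Longrightarrow> g \<in> A \<Longrightarrow> Src E (p (a, g)) = e a"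
    "\<And>a g. a \<in> A \<Longrightarrow> g \<in> A \<Longrightarrow> Tgt E (p (a, g)) = e (Comp H g a)"
    "\<And>a. a \<in> A \<Longrightarrow> Ident E (e a) = p (a, u)"
    "\<And>a g b h. a \<in> A \<Longrightarrow> g \<in> A \<Longrightarrow> b \<in> A \<Longrightarrow> h \<in> A \<Longrightarrow>
      Comp E (p (b, h)) (p (a, g)) = p (a, Comp H h g)"
    by (auto simp: E_def d q)
  have e_eq: "e a = e b \<longleftrightarrow> a = b" if "a \<in> A" "b \<in> A" for a b
    using e that by (auto simp: inj_on_def)
  have cat: "category E"
    using m assoc u by (auto simp: category_def Hom_def E e_eq)
  have grp: "groupoid E"
    unfolding groupoid_def
  proof (intro conjI ballI cat)
    fix f assume "f \<in> Arr E"
    then obtain a g where ag: "a \<in> A" "g \<in> A" "f = p (a, g)" by (auto simp: E)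
    note * = ag m i u
    show "f \<in> Isos E (Src E f) (Tgt E f)"
      unfolding Isos_def
    proof (intro CollectI conjI bexI)
      \<comment> \<open>The inverse of \<open>(a, g)\<close> starts at \<open>g a\<close> and
        translates by the inverse of \<open>g\<close>.\<close>
      show "p (Comp H g a, i g) \<in> Hom E (Tgt E f) (Src E f)"
        using * by (simp add: Hom_def E assoc[symmetric])
    qed (use * in \<open>simp_all add: Hom_def E\<close>)
  qed
  have "is_functor E H (\<lambda>_. x) (snd \<circ> q)"
    using cat groupoid_category[OF H] m
    by (auto simp: is_functor_def E q x A u_def[symmetric] u(1))
  \<comment> \<open>As \<open>H\<close> has a single object, the fibre over it is all of
    \<open>Obj E\<close>, a copy of \<open>A\<close>; this gives the number of sheets.\<close>
  moreover have "{y \<in> Obj E. x = z} = e ` A" if "z \<in> Obj H" for z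
    using that x by (auto simp: E)
  moreover have "\<exists>!g. g \<in> Arr E \<and> Src E g = y \<and> (snd \<circ> q) g = h" if h: "h \<in> Arr H" and y: "y \<in> Obj E" for h y
  proof -
    obtain a where "a \<in> A" "y = e a" using y by (auto simp: E)
    then show ?thesis
      using h by (intro ex1I[of _ "p (a, h)"]) (auto simp: E q e_eq A_def[symmetric])
  qed
  ultimately have cov: "sheeted_covering (card (Arr H)) E H (\<lambda>_. x) (snd \<circ> q)"
    using grp H finA u(1) card_image[OF e] by (auto simp: sheeted_covering_def x E A_def)
  \<comment> \<open>The action is free: only the unit fixes the unit under translation, so the
    object \<open>e u\<close> has no loop but its identity.\<close>
  have "a = u" if "a \<in> A" "Comp H a u = u" for a
    using that u by simp
  then have pt: "Arr (full_subcat E {e u}) = {Ident E (e u)}"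
    using u by (auto simp: E e_eq m)
  have conn: "Hom E z (e u) \<noteq> {}" if z: "z \<in> Obj E" for z
  proof -
    obtain a where a: "a \<in> A" "z = e a" using z by (auto simp: E)
    \<comment> \<open>The action is transitive: translation by the inverse of \<open>a\<close>
      carries \<open>a\<close> to the unit.\<close>
    then have "p (a, i a) \<in> Hom E z (e u)" using i by (auto simp: Hom_def E)
    then show ?thesis by blast
  qed
  show thesis
    by (rule that[OF grp _ _ cov _ pt conn]) (use finA u in \<open>auto simp: E\<close>)
qed

section \<open>Groupoid measures\<close>

context
  fixes \<mu> :: "('o::infinite, 'm::infinite) cat_data \<Rightarrow> real"
  assumes equiv: "\<And>G H. tame G \<Longrightarrow> tame H \<Longrightarrow> equivalent G H \<Longrightarrow> \<mu> G = \<mu> H"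
    and point: "\<And>G. groupoid G \<Longrightarrow> card (Obj G) = 1 \<Longrightarrow> card (Arr G) = 1 \<Longrightarrow> \<mu> G = 1"
    and covering: "\<And>G H k Fo Fa. tame G \<Longrightarrow> tame H \<Longrightarrow> sheeted_covering k G H Fo Fa \<Longrightarrow>
        \<mu> G = real k * \<mu> H"
    and union: "\<And>G H K. tame G \<Longrightarrow> tame H \<Longrightarrow> tame K \<Longrightarrow> isomorphic K (disjoint_union G H) \<Longrightarrow>
        \<mu> K = \<mu> G + \<mu> H"
begin

lemma measure_one_object:
  assumes H: "groupoid H" and x: "Obj H = {x}" and fin: "finite (Arr H)"
  shows "\<mu> H = 1 / card (Arr H)"
proof -
  have tame: "tame K" if "groupoid K" "finite (Obj K)" "finite (Arr K)" for K :: "('o, 'm) cat_data"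
  proof (rule tame_if_finite_iso_classes[OF that(1)])
    show "finite (iso_classes K)" using that by (simp add: iso_classes_def)
    show "finite (Aut K y)" for y
      using that by (auto simp: Isos_def Hom_def)
  qed
  obtain E :: "('o, 'm) cat_data" and Fo Fa y where
    E: "groupoid E" "finite (Obj E)" "finite (Arr E)" "sheeted_covering (card (Arr H)) E H Fo Fa"
    "y \<in> Obj E" "Arr (full_subcat E {y}) = {Ident E y}" "\<And>z. z \<in> Obj E \<Longrightarrow> Hom E z y \<noteq> {}"
    using translation_covering[OF assms] by metis
  let ?P = "full_subcat E {y}"
  have P: "groupoid ?P" "Obj ?P = {y}"
    using E by (auto simp: groupoid_full_subcat)
  have "\<mu> E = \<mu> ?P"
    using equivalent_full_subcat[OF E(1), of "{y}"] E P tame by (intro equiv[symmetric]) auto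
  also have "\<mu> ?P = 1"
    using P E(6) by (intro point) auto
  finally have "card (Arr H) * \<mu> H = 1"
    using covering[OF tame tame E(4)] E(1-3) H x fin by simp
  \<comment> \<open>That the product is 1 also shows \<open>card (Arr H)\<close> to be nonzero, so
    division is legitimate.\<close>
  then show ?thesis
    by (metis mult_zero_left nonzero_eq_divide_eq mult.commute zero_neq_one)
qed

text \<open>Any two objects of the class are joined by an arrow, so the component is equivalent to
  the full subgroupoid on \<open>x\<close>, a one-object groupoid whose arrows form
  \<open>Aut G x\<close>.\<close>

lemma measure_iso_class:
  assumes G: "groupoid G" and x: "x \<in> Obj G" and Aut: "\<And>y. y \<in> Obj G \<Longrightarrow> finite (Aut G y)"
  shows "\<mu> (full_subcat G (iso_class G x)) = 1 / card (Aut G x)"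
proof -
  let ?C = "full_subcat G (iso_class G x)" and ?H = "full_subcat G {x}"
  have C: "groupoid ?C" and H: "groupoid ?H"
    using G by (simp_all add: groupoid_full_subcat)
  have xc: "x \<in> iso_class G x" using iso_class_self[OF G x] .
  \<comment> \<open>The equivalence lemma compares a groupoid with a full subgroupoid of it, so
    \<open>?H\<close> is viewed inside the component instead of inside \<open>G\<close>.\<close>
  have HC: "?H = full_subcat ?C {x}"
    using xc by (simp add: full_subcat_full_subcat Int_insert_right)
  have Arr: "Arr ?H = Aut G x"
    by (auto simp: Isos_eq_Hom[OF G] Hom_def)
  have conn: "Hom G y z \<noteq> {}" if "y \<in> iso_class G x" "z \<in> iso_class G x" for y z
  proof -
    have "iso_class G x \<in> iso_classes G" using x by (simp add: iso_classes_def)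
    then show ?thesis
      using that mem_iso_classes_iff[OF G] iso_class_eq_iff[OF G] by metis
  qed
  have "iso_class ?C y = iso_class ?C x" if "y \<in> Obj ?C" for y
    using iso_class_eq_iff[OF C that, of x] conn[of y x] that xc x by (simp add: Hom_full_subcat)
  then have "iso_classes ?C \<subseteq> {iso_class ?C x}"
    unfolding iso_classes_def by blast
  then have "tame ?C"
    using Aut by (intro tame_if_finite_iso_classes[OF C])
      (auto intro: finite_subset simp: Isos_full_subcat[OF G])
  moreover have "tame ?H"
    using Aut by (intro tame_if_finite_iso_classes[OF H])
      (auto simp: Isos_full_subcat[OF G] iso_classes_def)
  moreover have "equivalent ?H ?C"
    unfolding HC using conn xc by (intro equivalent_full_subcat[OF C]) (auto simp: Hom_full_subcat)
  ultimately have "\<mu> ?C = \<mu> ?H"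
    using equiv by metis
  also have "\<dots> = 1 / card (Aut G x)"
    using measure_one_object[OF H, of x] x Aut Arr by auto
  finally show ?thesis .
qed

text \<open>Over the empty groupoid the fibre condition is vacuous, so the identity is a covering
  with 0 sheets and the value is 0 times itself. This starts the induction over finite sets of
  classes.\<close>

lemma measure_empty:
  assumes "groupoid G" "Obj G = {}"
  shows "\<mu> G = 0"
proof -
  have "Arr G = {}" using Src_in_Obj[OF assms(1)] assms(2) by auto
  then have "sheeted_covering 0 G G id id"
    using assms groupoid_category[OF assms(1)] by (simp add: sheeted_covering_def is_functor_def)
  moreover have "tame G"
    using assms by (intro tame_if_finite_iso_classes) (auto simp: iso_classes_def)
  ultimately show ?thesis using covering by fastforce
qed

text \<open>Induction on \<open>C\<close>: additivity splits off one component at a time, and the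
  value of a component is known.\<close>

lemma measure_finite_iso_classes:
  assumes G: "groupoid G" and Aut: "\<And>y. y \<in> Obj G \<Longrightarrow> finite (Aut G y)"
    and "finite C" "C \<subseteq> iso_classes G"
  shows "\<mu> (full_subcat G (\<Union>C)) = (\<Sum>c\<in>C. 1 / card (Aut G (SOME x. x \<in> c)))"
  using assms(3,4)
proof (induction C rule: finite_induct)
  case empty
  show ?case using measure_empty[OF groupoid_full_subcat[OF G]] by simp
next
  case (insert c C)
  \<comment> \<open>Additivity applies to tame groupoids only. Distinct classes are disjoint, so
    only members of \<open>D\<close> meet \<open>\<Union>D\<close>, and the subgroupoid has finitely
    many classes.\<close>
  have tame: "tame (full_subcat G (\<Union>D))" if D: "finite D" "D \<subseteq> iso_classes G" for D
  proof (rule tame_if_finite_iso_classes[OF groupoid_full_subcat[OF G]])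
    have "{c \<in> iso_classes G. c \<inter> \<Union>D \<noteq> {}} \<subseteq> D"
    proof
      fix c assume "c \<in> {c \<in> iso_classes G. c \<inter> \<Union>D \<noteq> {}}"
      then obtain d x where c: "c \<in> iso_classes G" and d: "d \<in> D" and x: "x \<in> c" "x \<in> d"
        by blast
      have "d \<in> iso_classes G" using d D by blast
      then have "c = d"
        using mem_iso_classes_iff[OF G c, of x] mem_iso_classes_iff[OF G, of d x] x by simp
      then show "c \<in> D" using d by simp
    qed
    then have "finite {c \<in> iso_classes G. c \<inter> \<Union>D \<noteq> {}}"
      using D(1) finite_subset by blast
    then show "finite (iso_classes (full_subcat G (\<Union>D)))"
      by (rule finite_subset[OF iso_classes_full_subcat[OF G] finite_imageI])
  qed (auto simp: Isos_full_subcat[OF G] Aut)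
  \<comment> \<open>A union of classes is closed under arrows in both directions, as the splitting
    into a disjoint union requires.\<close>
  have sat: "Src G f \<in> \<Union>D \<longleftrightarrow> Tgt G f \<in> \<Union>D" if "f \<in> Arr G" "D \<subseteq> iso_classes G" for f D
  proof -
    have "x \<in> \<Union>D \<longleftrightarrow> iso_class G x \<in> D" if "x \<in> Obj G" for x
    proof
      assume "x \<in> \<Union>D"
      then obtain d where d: "d \<in> D" "x \<in> d" by blast
      then have "d \<in> iso_classes G" using \<open>D \<subseteq> iso_classes G\<close> by blast
      from mem_iso_classes_iff[OF G this, of x] d show "iso_class G x \<in> D" by simp
    qed (use iso_class_self[OF G that] in blast)
    then show ?thesis
      using that iso_class_Src_Tgt[OF G] Src_in_Obj[OF G] Tgt_in_Obj[OF G] by simp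
  qed
  have "c \<inter> \<Union>C = {}"
  proof (rule ccontr)
    assume "c \<inter> \<Union>C \<noteq> {}"
    then obtain d x where d: "d \<in> C" "x \<in> c" "x \<in> d" by blast
    then have "c \<in> iso_classes G" "d \<in> iso_classes G" using insert.prems by auto
    then have "c = d"
      using mem_iso_classes_iff[OF G, of c x] mem_iso_classes_iff[OF G, of d x] d by simp
    then show False using d insert.hyps by simp
  qed
  then have "isomorphic (full_subcat G (\<Union>{c} \<union> \<Union>C))
      (disjoint_union (full_subcat G (\<Union>{c})) (full_subcat G (\<Union>C)))"
    using insert.prems by (intro isomorphic_disjoint_union_full_subcat[OF G] sat) auto
  then have "\<mu> (full_subcat G (\<Union>(insert c C))) = \<mu> (full_subcat G c) + \<mu> (full_subcat G (\<Union>C))"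
    using union[OF tame[of "{c}"] tame[of C] tame[of "insert c C"]] insert by simp
  moreover have "\<mu> (full_subcat G c) = 1 / card (Aut G (SOME x. x \<in> c))"
    using measure_iso_class[OF G _ Aut] some_mem_iso_class[OF G, of c] mem_iso_classes_iff[OF G, of c]
      insert.prems by (metis insert_subset)
  ultimately show ?case using insert by simp
qed

end

section \<open>Filtration stages and the passage to the limit\<close>

lemma filtration_stage_eq_full_subcat:
  assumes G: "groupoid G"
  shows "filtration_stage G f n = full_subcat G (\<Union>{c \<in> iso_classes G. f c \<le> n})"
proof -
  have *: "x \<in> \<Union>{c \<in> iso_classes G. f c \<le> n} \<longleftrightarrow> f (iso_class G x) \<le> n" if "x \<in> Obj G" for x
    using that mem_iso_classes_iff[OF G] by (auto simp: iso_classes_def)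
  let ?S = "\<Union>{c \<in> iso_classes G. f c \<le> n}"
  have "x \<in> Obj (filtration_stage G f n) \<longleftrightarrow> x \<in> Obj (full_subcat G ?S)" for x
    using * by (auto simp: filtration_stage_def filtration_piece_def simp del: Union_iff)
  \<comment> \<open>Source and target of an arrow are isomorphic, so every arrow between objects of
    the stage already lies in a single piece; the union of the pieces is therefore full.\<close>
  moreover have "a \<in> Arr (filtration_stage G f n) \<longleftrightarrow> a \<in> Arr (full_subcat G ?S)" for a
  proof (cases "a \<in> Arr G")
    case True
    show ?thesis
      using *[OF Src_in_Obj[OF G True]] *[OF Tgt_in_Obj[OF G True]] iso_class_Src_Tgt[OF G True] True
      by (simp add: filtration_stage_def filtration_piece_def del: Union_iff)
  qed (simp add: filtration_stage_def filtration_piece_def)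
  ultimately show ?thesis
    by (intro cat_data.equality set_eqI) (simp_all add: filtration_stage_def)
qed

theorem theorem2p8:
  fixes \<mu> :: "('o::infinite, 'm::infinite) cat_data \<Rightarrow> real"
  assumes equiv: "\<And>G H. tame G \<Longrightarrow> tame H \<Longrightarrow> equivalent G H \<Longrightarrow> \<mu> G = \<mu> H"
    and point: "\<And>G. groupoid G \<Longrightarrow> card (Obj G) = 1 \<Longrightarrow> card (Arr G) = 1 \<Longrightarrow> \<mu> G = 1"
    and covering: "\<And>G H k Fo Fa. tame G \<Longrightarrow> tame H \<Longrightarrow> sheeted_covering k G H Fo Fa \<Longrightarrow>
        \<mu> G = real k * \<mu> H"
    and union: "\<And>G H K. tame G \<Longrightarrow> tame H \<Longrightarrow> tame K \<Longrightarrow> isomorphic K (disjoint_union G H) \<Longrightarrow>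
        \<mu> K = \<mu> G + \<mu> H"
    and filtration: "\<And>G f. tame G \<Longrightarrow> f ` iso_classes G = (UNIV :: nat set) \<Longrightarrow>
        (\<lambda>n. \<mu> (filtration_stage G f n)) \<longlonglongrightarrow> \<mu> G"
  shows "\<forall>G. tame G \<longrightarrow> \<mu> G = enn2real (groupoid_card G)"
proof (intro allI impI)
  fix G :: "('o, 'm) cat_data" assume tame: "tame G"
  have G: "groupoid G" and Aut: "\<And>y. y \<in> Obj G \<Longrightarrow> finite (Aut G y)"
    and count: "countable (iso_classes G)"
    using tame by (auto simp: tame_def)
  define w where "w c = card (Aut G (SOME x. x \<in> c))" for c
  have "w c > 0" if "c \<in> iso_classes G" for c
    using some_mem_iso_class[OF G that] mem_iso_classes_iff[OF G that] card_Aut_pos[OF G] Aut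
    unfolding w_def by blast
  \<comment> \<open>Positivity of \<open>w c\<close> matters: 1 / 0 is \<infinity> in
    \<open>ennreal\<close> but 0 in the reals.\<close>
  then have w: "1 / of_nat (w c) = ennreal (1 / real (w c))" if "c \<in> iso_classes G" for c
    using that by (simp add: divide_ennreal ennreal_of_nat_eq_real_of_nat flip: ennreal_1)
  have sum_w: "(\<Sum>c\<in>C. 1 / of_nat (w c)) = ennreal (\<Sum>c\<in>C. 1 / real (w c))"
    if "C \<subseteq> iso_classes G" for C
  proof -
    have "(\<Sum>c\<in>C. 1 / of_nat (w c)) = (\<Sum>c\<in>C. ennreal (1 / real (w c)))"
      using that w by (intro sum.cong refl) blast
    then show ?thesis by (simp only: sum_ennreal of_nat_0_le_iff zero_le_divide_1_iff)
  qed
  have \<mu>: "\<mu> (full_subcat G (\<Union>C)) = (\<Sum>c\<in>C. 1 / real (w c))" if "finite C" "C \<subseteq> iso_classes G" for C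
    unfolding w_def
    by (rule measure_finite_iso_classes[OF equiv point covering union G Aut that])
  have card_eq: "groupoid_card G = (\<Sum>\<^sub>\<infinity>c\<in>iso_classes G. 1 / of_nat (w c))"
    by (simp add: groupoid_card_def w_def)
  show "\<mu> G = enn2real (groupoid_card G)"
  proof (cases "finite (iso_classes G)")
    \<comment> \<open>Finitely many classes admit no surjection onto the natural numbers, hence no
      filtration; here additivity alone gives the value.\<close>
    case True
    have "full_subcat G (\<Union>(iso_classes G)) = G"
      using iso_class_self[OF G] by (intro full_subcat_Obj[OF G]) (auto simp: iso_classes_def)
    then have "\<mu> G = (\<Sum>c\<in>iso_classes G. 1 / real (w c))"
      using \<mu>[OF True] by simp
    then show ?thesis
      using True sum_w by (simp add: card_eq sum_nonneg)
  next
    case False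
    \<comment> \<open>An enumeration of the classes is in particular a surjection, so it defines a
      filtration, whose stage \<open>n\<close> consists of the \<open>n + 1\<close> classes in
      \<open>C n\<close>.\<close>
    then obtain f :: "_ \<Rightarrow> nat" where f: "bij_betw f (iso_classes G) UNIV"
      using countableE_infinite[OF count] by metis
    define C where "C n = {c \<in> iso_classes G. f c \<le> n}" for n
    have C: "bij_betw f (C n) {..n}" for n
      using f by (rule bij_betw_subset) (use f in \<open>auto simp: C_def bij_betw_def image_iff\<close>)
    have finC: "finite (C n)" for n
      using bij_betw_finite[OF C] by simp
    \<comment> \<open>\<open>g\<close> inverts the enumeration and \<open>v\<close> lists the
      summands in its order, turning the unordered sum into a series.\<close>
    define g where "g = inv_into (iso_classes G) f"
    define v :: "nat \<Rightarrow> ennreal" where "v n = 1 / of_nat (w (g n))" for n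
    have v: "v (f c) = 1 / of_nat (w c)" if "c \<in> iso_classes G" for c
      using f that by (simp add: v_def g_def bij_betw_def)
    have "groupoid_card G = (\<Sum>\<^sub>\<infinity>c\<in>iso_classes G. v (f c))"
      unfolding card_eq by (intro infsum_cong) (simp add: v)
    also have "\<dots> = infsum v UNIV"
      by (rule infsum_reindex_bij_betw[OF f])
    finally have "(v has_sum groupoid_card G) UNIV"
      by (simp add: nonneg_summable_on_complete)
    then have "(\<lambda>n. \<Sum>i\<le>n. v i) \<longlonglongrightarrow> groupoid_card G"
      using has_sum_imp_sums sums_def_le by blast
    \<comment> \<open>The partial sums up to and including \<open>n\<close> are the values of
      \<open>\<mu>\<close> on the stages, so the two limits can be compared in
      \<open>ennreal\<close>.\<close>
    moreover have "(\<Sum>i\<le>n. v i) = ennreal (\<mu> (filtration_stage G f n))" for n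
    proof -
      have "(\<Sum>i\<le>n. v i) = (\<Sum>c\<in>C n. v (f c))"
        by (rule sum.reindex_bij_betw[OF C, symmetric])
      also have "\<dots> = (\<Sum>c\<in>C n. 1 / of_nat (w c))"
        by (intro sum.cong) (auto simp: v C_def)
      also have "\<dots> = ennreal (\<Sum>c\<in>C n. 1 / real (w c))"
        by (rule sum_w) (auto simp: C_def)
      also have "\<dots> = ennreal (\<mu> (full_subcat G (\<Union>(C n))))"
        by (subst \<mu>) (use finC in \<open>auto simp: C_def\<close>)
      finally show ?thesis
        by (simp add: filtration_stage_eq_full_subcat[OF G] C_def)
    qed
    ultimately have "(\<lambda>n. ennreal (\<mu> (filtration_stage G f n))) \<longlonglongrightarrow> groupoid_card G"
      by simp
    moreover have "(\<lambda>n. ennreal (\<mu> (filtration_stage G f n))) \<longlonglongrightarrow> ennreal (\<mu> G)"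
      using filtration[OF tame] f by (intro tendsto_ennrealI) (simp add: bij_betw_def)
    \<comment> \<open>\<open>ennreal\<close> sends negative reals to 0, so \<open>\<mu> G\<close>
      can be recovered from \<open>ennreal (\<mu> G)\<close> only once its sign is known; it is a
      limit of nonnegative finite sums.\<close>
    moreover have "\<mu> G \<ge> 0"
    proof (rule LIMSEQ_le_const[OF filtration[OF tame, of f]])
      have "0 \<le> \<mu> (filtration_stage G f n)" for n
        unfolding filtration_stage_eq_full_subcat[OF G] C_def[symmetric]
        by (subst \<mu>) (use finC in \<open>auto simp: C_def intro: sum_nonneg\<close>)
      then show "\<exists>N. \<forall>n\<ge>N. 0 \<le> \<mu> (filtration_stage G f n)" by blast
    qed (use f in \<open>simp add: bij_betw_def\<close>)
    ultimately show ?thesis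
      using LIMSEQ_unique by fastforce
  qed
qed

end
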